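(* Let $B$ be either a finite Blaschke product, or an interpolating Blaschke product whose zeros are real and cluster (only) at the point $p=1$. Then $f:=BS\in\mathfrak I_c$, where $S(z)=\exp\left(-\frac{1+z}{1-z}\right)$.
   Context: $\mathbb D$ is the open unit disk. $S$ is the atomic inner function on $\mathbb D$. A Blaschke product $b$ with zero sequence $(z_n)_{n\in\mathbb N}$ is an interpolating Blaschke product if $\inf_n (1-|z_n|^2)|b'(z_n)|>0$. $\mathfrak I_c$ denotes the set of one-component inner functions: inner functions $u$ for which there is $\eta\in\,]0,1[$ such that $\Omega_u(\eta)=\{z\in\mathbb D:|u(z)|<\eta\}$ is connected. *)

theory Defs
  imports "HOL-Complex_Analysis.Complex_Analysis"
begin

abbreviation unit_disk :: "complex set" where
  "unit_disk \<equiv> ball 0 1"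

(* Functions on the disk are total functions on the complex plane of which only the
   values on the open unit disk matter. *)
definition inner_function :: "(complex \<Rightarrow> complex) \<Rightarrow> bool" where
  "inner_function u \<longleftrightarrow>
     u holomorphic_on unit_disk \<and>
     (\<forall>z\<in>unit_disk. norm (u z) \<le> 1) \<and>
     (AE t\<in>{0..2 * pi} in lborel.
        \<exists>l. ((\<lambda>r. u (of_real r * cis t)) \<longlongrightarrow> l) (at_left 1) \<and> norm l = 1)"

definition sublevel :: "(complex \<Rightarrow> complex) \<Rightarrow> real \<Rightarrow> complex set" where
  "sublevel u \<eta> = {z \<in> unit_disk. norm (u z) < \<eta>}"

(* The library counts the empty set as connected; this only concerns unimodular constants,
   since a non-constant inner function has infimum 0 in modulus on the disk. *)
definition one_component_inner :: "(complex \<Rightarrow> complex) \<Rightarrow> bool" where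
  "one_component_inner u \<longleftrightarrow>
     inner_function u \<and> (\<exists>\<eta>. 0 < \<eta> \<and> \<eta> < 1 \<and> connected (sublevel u \<eta>))"

definition atomic_inner :: "complex \<Rightarrow> complex" where
  "atomic_inner z = exp (- ((1 + z) / (1 - z)))"

definition blaschke_factor :: "complex \<Rightarrow> complex \<Rightarrow> complex" where
  "blaschke_factor a z =
     (if a = 0 then z else of_real (norm a) / a * ((a - z) / (1 - cnj a * z)))"

(* Zeros are listed with multiplicity; the empty list gives the unimodular constants. *)
definition finite_blaschke_product :: "(complex \<Rightarrow> complex) \<Rightarrow> bool" where
  "finite_blaschke_product b \<longleftrightarrow>
     (\<exists>c as. norm c = 1 \<and> set as \<subseteq> unit_disk \<and>
        (\<forall>w\<in>unit_disk. b w = c * (\<Prod>a\<leftarrow>as. blaschke_factor a w)))"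

(* The Blaschke product with infinite zero sequence z, zeros repeated by multiplicity.  The
   summability condition makes the product converge on the whole disk. *)
definition blaschke_product :: "(complex \<Rightarrow> complex) \<Rightarrow> (nat \<Rightarrow> complex) \<Rightarrow> bool" where
  "blaschke_product b z \<longleftrightarrow>
     range z \<subseteq> unit_disk \<and> summable (\<lambda>n. 1 - norm (z n)) \<and>
     (\<exists>c. norm c = 1 \<and>
        (\<forall>w\<in>unit_disk. b w = c * prodinf (\<lambda>n. blaschke_factor (z n) w)))"

(* Positivity of the infimum forces the zeros to be simple, so z is injective. *)
definition interpolating_blaschke_product ::
    "(complex \<Rightarrow> complex) \<Rightarrow> (nat \<Rightarrow> complex) \<Rightarrow> bool" where
  "interpolating_blaschke_product b z \<longleftrightarrow>
     blaschke_product b z \<and>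
     (INF n. (1 - (norm (z n))\<^sup>2) * norm (deriv b (z n))) > 0"

end

theory Submission
  imports Defs
begin

text \<open>
  Move to the right half-plane by \<open>w = (1 + z) / (1 - z)\<close>. There \<open>S\<close> becomes \<open>exp (- w)\<close>, of modulus
  \<open>exp (- Re w)\<close>, and a Blaschke factor with zero \<open>p\<close> has modulus \<open>|w - p| / |w + cnj p|\<close>. Along a
  horizontal line that quotient decreases as \<open>Re w\<close> grows from 0 to \<open>Re p\<close>, because
  \<open>1 - |w - p|\<^sup>2 / |w + cnj p|\<^sup>2 = 4 * Re p * Re w / |w + cnj p|\<^sup>2\<close> and \<open>x / ((x + s)\<^sup>2 + t)\<close> with \<open>t \<ge> 0\<close>
  increases in \<open>x\<close> on \<open>]0, s]\<close>.

  The zeros of \<open>B\<close>, in either case, all satisfy \<open>Re p \<ge> L\<close> for one \<open>L > 0\<close>: for finitely many this is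
  clear, and real zeros that do not accumulate at -1 stay at a positive distance from it. Hence
  \<open>|B S|\<close> decreases along horizontal lines as long as \<open>Re w \<le> L\<close>, and it is at most \<open>exp (- L)\<close> on the
  half-plane \<open>Re w \<ge> L\<close>. For \<open>\<eta> = exp (- L / 2)\<close> the sublevel set therefore contains this
  half-plane, and from each of its other points the horizontal segment leading to the half-plane
  stays inside the sublevel set. Such a set is connected
  (\<open>connected_half_plane_union_segments\<close>).

  That \<open>B S\<close> is inner follows from a continuous extension. In the disk, \<open>Re p \<ge> L\<close> describes a closed
  horodisk, which meets the unit circle in 1 only. So on a compact subset of the closed disk that
  avoids 1, the denominators \<open>1 - cnj a * z\<close> are bounded away from 0 uniformly in the zeros \<open>a\<close>, and
  the product converges uniformly there. Consequently \<open>B S\<close> extends continuously, with modulus 1,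
  to the circle without the point 1.
\<close>

section \<open>Blaschke factors on the closed disk\<close>

lemma norm_blaschke_factor:
  "norm (blaschke_factor a z) = norm (a - z) / norm (1 - cnj a * z)"
  by (simp add: blaschke_factor_def norm_mult norm_divide)

lemma norm_blaschke_denominator_identity:
  "(norm (1 - cnj a * z))\<^sup>2 - (norm (a - z))\<^sup>2 = (1 - (norm a)\<^sup>2) * (1 - (norm z)\<^sup>2)"
  by (simp add: cmod_power2) algebra

lemma norm_blaschke_factor_le_1:
  assumes "norm a \<le> 1" "norm z \<le> 1"
  shows "norm (blaschke_factor a z) \<le> 1"
proof -
  have "(norm (a - z))\<^sup>2 \<le> (norm (1 - cnj a * z))\<^sup>2"
    using norm_blaschke_denominator_identity[of a z] assms
    by (smt (verit) mult_nonneg_nonneg norm_ge_zero power_le_one)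
  then have "norm (a - z) \<le> norm (1 - cnj a * z)"
    by (rule power2_le_imp_le) simp
  then show ?thesis
    by (simp add: norm_blaschke_factor divide_le_eq_1)
qed

lemma norm_blaschke_factor_eq_1:
  assumes "norm z = 1" "cnj a * z \<noteq> 1"
  shows "norm (blaschke_factor a z) = 1"
proof -
  have "(norm (a - z))\<^sup>2 = (norm (1 - cnj a * z))\<^sup>2"
    using norm_blaschke_denominator_identity[of a z] assms by simp
  then have "norm (a - z) = norm (1 - cnj a * z)"
    by simp
  then show ?thesis
    using assms by (simp add: norm_blaschke_factor)
qed

text \<open>
  The normalising constant \<open>norm a / a\<close> brings the factor close to 1 when \<open>norm a\<close> is, which turns the
  Blaschke condition on the zeros into convergence of the product.
\<close>

lemma norm_blaschke_factor_minus_1_le: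
  assumes "norm a \<le> 1" "norm z \<le> 1" "cnj a * z \<noteq> 1"
  shows "norm (blaschke_factor a z - 1) \<le> 2 * (1 - norm a) / norm (1 - cnj a * z)"
proof (cases "a = 0")
  case True
  have "norm (z - 1) \<le> norm z + 1"
    by (metis norm_one norm_triangle_ineq4)
  with True assms show ?thesis
    by (simp add: blaschke_factor_def)
next
  case False
  have aa: "a * cnj a = of_real (norm a) * of_real (norm a)"
    by (metis complex_norm_square of_real_mult power2_eq_square)
  then have aaz: "a * (cnj a * z) = of_real (norm a) * (of_real (norm a) * z)"
    by (simp only: mult.assoc[symmetric])
  have ne: "1 - cnj a * z \<noteq> 0"
    using assms by auto
  have "1 - blaschke_factor a z
      = (a * (1 - cnj a * z) - of_real (norm a) * (a - z)) / (a * (1 - cnj a * z))"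
    using False ne by (subst diff_divide_distrib) (simp add: blaschke_factor_def)
  also have "a * (1 - cnj a * z) - of_real (norm a) * (a - z)
      = of_real (1 - norm a) * (a + of_real (norm a) * z)"
    using aa by (simp add: right_diff_distrib left_diff_distrib distrib_left aaz mult.commute)
  finally have eq: "norm (1 - blaschke_factor a z)
      = (1 - norm a) * norm (a + of_real (norm a) * z) / (norm a * norm (1 - cnj a * z))"
    using assms(1) by (simp add: norm_mult norm_divide del: of_real_diff)
  have "norm (a + of_real (norm a) * z) \<le> norm a + norm a * norm z"
    using norm_triangle_ineq[of a "of_real (norm a) * z"] by (simp add: norm_mult)
  also have "\<dots> \<le> norm a * 2"
    using assms mult_left_mono[of "norm z" 1 "norm a"] by simp
  finally have "norm (1 - blaschke_factor a z)
      \<le> (1 - norm a) * (norm a * 2) / (norm a * norm (1 - cnj a * z))"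
    unfolding eq using assms(1) by (intro divide_right_mono mult_left_mono) auto
  also have "\<dots> = 2 * (1 - norm a) / norm (1 - cnj a * z)"
    using False by simp
  finally show ?thesis
    by (simp add: norm_minus_commute)
qed

section \<open>Zeros in a horodisk\<close>

text \<open>
  The Cayley image of the closed half-plane \<open>Re w \<ge> L\<close>, multiplied out so that the boundary point 1,
  the image of infinity, belongs to it and the set is compact.
\<close>

definition horodisk :: "real \<Rightarrow> complex set" where
  "horodisk L = {a. L * (norm (1 - a))\<^sup>2 \<le> 1 - (norm a)\<^sup>2}"

lemma horodisk_norm_le_1:
  assumes "0 < L" "a \<in> horodisk L"
  shows "norm a \<le> 1"
proof -
  have "0 \<le> L * (norm (1 - a))\<^sup>2"
    using assms by simp
  also have "\<dots> \<le> 1 - (norm a)\<^sup>2"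
    using assms by (simp add: horodisk_def)
  finally show ?thesis
    by (simp add: abs_square_le_1)
qed

lemma horodisk_norm_eq_1:
  assumes "0 < L" "a \<in> horodisk L" "norm a = 1"
  shows "a = 1"
  using assms by (simp add: horodisk_def mult_le_0_iff)

lemma compact_horodisk:
  assumes "0 < L"
  shows "compact (horodisk L)"
proof -
  have "closed (horodisk L)"
    unfolding horodisk_def by (intro closed_Collect_le continuous_intros)
  moreover have "horodisk L \<subseteq> cball 0 1"
    using horodisk_norm_le_1[OF assms] by auto
  ultimately show ?thesis
    by (meson bounded_cball bounded_subset compact_eq_bounded_closed)
qed

lemma horodisk_cnj_mult_ne_1:
  assumes "0 < L" "a \<in> horodisk L" "norm z \<le> 1" "z \<noteq> 1"
  shows "cnj a * z \<noteq> 1"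
proof
  assume eq: "cnj a * z = 1"
  have "norm a * norm z = 1"
    by (metis eq complex_mod_cnj norm_mult norm_one)
  moreover have "norm a * norm z \<le> norm a * 1"
    using assms by (intro mult_left_mono) auto
  ultimately have "norm a = 1"
    using horodisk_norm_le_1[OF assms(1,2)] by linarith
  then have "a = 1"
    using horodisk_norm_eq_1 assms by blast
  with eq assms show False
    by simp
qed

text \<open>
  The equation \<open>cnj a * z = 1\<close> in the closed disk forces \<open>norm a = 1\<close>, so \<open>a = 1\<close> in the horodisk and then
  \<open>z = 1\<close>. Off 1 the denominator thus has no zero, and compactness in both variables makes the bound
  uniform.
\<close>

lemma blaschke_denominator_bounded_below:
  assumes L: "0 < L" and K: "compact K" "K \<subseteq> cball 0 1 - {1}"
  obtains d where "0 < d" "\<And>a z. a \<in> horodisk L \<Longrightarrow> z \<in> K \<Longrightarrow> d \<le> norm (1 - cnj a * z)"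
proof (cases "horodisk L \<times> K = {}")
  case True
  then show ?thesis
    using that[of 1] by auto
next
  case False
  have "compact (horodisk L \<times> K)"
    by (intro compact_Times compact_horodisk L K)
  moreover have "continuous_on (horodisk L \<times> K) (\<lambda>(a, z). norm (1 - cnj a * z))"
    unfolding case_prod_unfold by (intro continuous_intros)
  ultimately obtain q where q: "q \<in> horodisk L \<times> K"
      "\<And>r. r \<in> horodisk L \<times> K \<Longrightarrow>
        (\<lambda>(a, z). norm (1 - cnj a * z)) q \<le> (\<lambda>(a, z). norm (1 - cnj a * z)) r"
    using continuous_attains_inf[OF _ False] by blast
  from q(1) have q': "fst q \<in> horodisk L" "snd q \<in> cball 0 1 - {1}"
    using K(2) by auto
  show ?thesis
  proof (rule that[of "norm (1 - cnj (fst q) * snd q)"])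
    show "0 < norm (1 - cnj (fst q) * snd q)"
      using horodisk_cnj_mult_ne_1[OF L, of "fst q" "snd q"] q' by auto
  qed (use q(2) in \<open>force simp: case_prod_unfold\<close>)
qed

section \<open>The Blaschke product away from the point 1\<close>

text \<open>
  The entry \<open>a n = 1\<close> is admitted: its factor is \<open>(1 - z) / (1 - z)\<close>, which is 1 off the point 1. Finite
  Blaschke products are covered by padding their list of zeros with ones.
\<close>

locale horodisk_zeros =
  fixes L :: real and a :: "nat \<Rightarrow> complex"
  assumes L_pos: "0 < L"
    and zeros: "a n \<in> horodisk L"
    and summable_zeros: "summable (\<lambda>n. 1 - norm (a n))"
begin

definition P :: "complex \<Rightarrow> complex" where
  "P w = prodinf (\<lambda>n. blaschke_factor (a n) w)"

lemma zero_norm_le_1: "norm (a n) \<le> 1"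
  using horodisk_norm_le_1 L_pos zeros by blast

lemma denominator_ne_0:
  assumes "norm z \<le> 1" "z \<noteq> 1"
  shows "1 - cnj (a n) * z \<noteq> 0"
  using horodisk_cnj_mult_ne_1[OF L_pos zeros assms] by simp

lemma factor_deviation_bound:
  assumes "compact K" "K \<subseteq> cball 0 1 - {1}"
  obtains C where "\<And>n z. z \<in> K \<Longrightarrow> norm (blaschke_factor (a n) z - 1) \<le> C * (1 - norm (a n))"
proof -
  obtain d where d: "0 < d" "\<And>b z. b \<in> horodisk L \<Longrightarrow> z \<in> K \<Longrightarrow> d \<le> norm (1 - cnj b * z)"
    using blaschke_denominator_bounded_below[OF L_pos assms] by blast
  show ?thesis
  proof (rule that[of "2 / d"])
    fix n z assume z: "z \<in> K"
    then have z': "norm z \<le> 1" "z \<noteq> 1"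
      using assms(2) by auto
    have "norm (blaschke_factor (a n) z - 1) \<le> 2 * (1 - norm (a n)) / norm (1 - cnj (a n) * z)"
      using norm_blaschke_factor_minus_1_le[OF zero_norm_le_1 z'(1)] denominator_ne_0[OF z', of n]
      by simp
    also have "\<dots> \<le> 2 * (1 - norm (a n)) / d"
      using d zeros z zero_norm_le_1 by (intro divide_left_mono) (auto intro!: mult_pos_pos dest: order.strict_trans2)
    finally show "norm (blaschke_factor (a n) z - 1) \<le> 2 / d * (1 - norm (a n))"
      by simp
  qed
qed

lemma partial_products_tendsto:
  assumes "norm z \<le> 1" "z \<noteq> 1"
  shows "(\<lambda>N. \<Prod>n<N. blaschke_factor (a n) z) \<longlonglongrightarrow> P z"
proof -
  obtain C where C: "\<And>n. norm (blaschke_factor (a n) z - 1) \<le> C * (1 - norm (a n))"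
    using factor_deviation_bound[of "{z}"] assms by auto
  have "summable (\<lambda>n. norm (blaschke_factor (a n) z - 1))"
    by (rule summable_comparison_test'[OF summable_mult[OF summable_zeros, of C]])
       (use C in auto)
  then have "convergent_prod (\<lambda>n. blaschke_factor (a n) z)"
    using abs_convergent_prod_conv_summable abs_convergent_prod_imp_convergent_prod by blast
  then have "(\<lambda>N. \<Prod>n\<le>N. blaschke_factor (a n) z) \<longlonglongrightarrow> P z"
    unfolding P_def by (rule convergent_prod_LIMSEQ)
  then have "(\<lambda>N. \<Prod>n<Suc N. blaschke_factor (a n) z) \<longlonglongrightarrow> P z"
    by (simp only: lessThan_Suc_atMost)
  then show ?thesis
    by (subst (asm) filterlim_sequentially_Suc)
qed

lemma holomorphic_factor:
  "blaschke_factor (a n) holomorphic_on cball 0 1 - {1}"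
proof -
  have "(\<lambda>z. if a n = 0 then z else of_real (norm (a n)) / a n * ((a n - z) / (1 - cnj (a n) * z)))
      holomorphic_on cball 0 1 - {1}"
    by (cases "a n = 0") (use denominator_ne_0 in \<open>auto intro!: holomorphic_intros\<close>)
  then show ?thesis
    by (simp add: blaschke_factor_def[abs_def])
qed

lemma uniform_limit_partial_products:
  assumes K: "compact K" "K \<subseteq> cball 0 1 - {1}"
  shows "uniform_limit K (\<lambda>N z. \<Prod>n<N. blaschke_factor (a n) z) P sequentially"
proof -
  obtain C where C: "\<And>n z. z \<in> K \<Longrightarrow> norm (blaschke_factor (a n) z - 1) \<le> C * (1 - norm (a n))"
    using factor_deviation_bound[OF K] by blast
  have "uniformly_convergent_on K (\<lambda>N z. \<Prod>n<N. blaschke_factor (a n) z)"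
  proof (rule uniformly_convergent_on_prod'[OF _ K(1)])
    show "continuous_on K (blaschke_factor (a n))" for n
      using holomorphic_on_imp_continuous_on[OF holomorphic_factor] K(2) continuous_on_subset
      by blast
    show "uniformly_convergent_on K (\<lambda>N z. \<Sum>n<N. norm (blaschke_factor (a n) z - 1))"
      by (rule Weierstrass_m_test'[OF _ summable_mult[OF summable_zeros, of C]])
         (use C in auto)
  qed
  then obtain l where l: "uniform_limit K (\<lambda>N z. \<Prod>n<N. blaschke_factor (a n) z) l sequentially"
    by (auto simp: uniformly_convergent_on_def)
  have "l z = P z" if "z \<in> K" for z
  proof (rule LIMSEQ_unique[OF tendsto_uniform_limitI[OF l that] partial_products_tendsto])
    show "norm z \<le> 1" "z \<noteq> 1"
      using K(2) that by auto
  qed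
  with l show ?thesis
    by (auto cong: uniform_limit_cong')
qed

lemma continuous_on_P:
  assumes K: "compact K" "K \<subseteq> cball 0 1 - {1}"
  shows "continuous_on K P"
proof (rule uniform_limit_theorem[OF _ uniform_limit_partial_products[OF K]])
  have "continuous_on K (\<lambda>z. \<Prod>n<N. blaschke_factor (a n) z)" for N
    using holomorphic_on_imp_continuous_on[OF holomorphic_factor] K(2) continuous_on_subset
    by (intro continuous_on_prod) blast
  then show "\<forall>\<^sub>F N in sequentially. continuous_on K (\<lambda>z. \<Prod>n<N. blaschke_factor (a n) z)"
    by simp
qed simp

lemma holomorphic_P: "P holomorphic_on unit_disk"
proof (rule holomorphic_uniform_sequence)
  show "(\<lambda>z. \<Prod>n<N. blaschke_factor (a n) z) holomorphic_on unit_disk" for N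
    by (intro holomorphic_on_prod holomorphic_on_subset[OF holomorphic_factor]) auto
next
  fix z :: complex assume "z \<in> unit_disk"
  then obtain d where d: "0 < d" "cball z d \<subseteq> unit_disk"
    using open_contains_cball[THEN iffD1, OF open_ball] by blast
  moreover have "unit_disk \<subseteq> cball 0 1 - {1}"
    by auto
  ultimately have "cball z d \<subseteq> cball 0 1 - {1}"
    by blast
  then show "\<exists>d>0. cball z d \<subseteq> unit_disk \<and>
      uniform_limit (cball z d) (\<lambda>N z. \<Prod>n<N. blaschke_factor (a n) z) P sequentially"
    using d uniform_limit_partial_products[OF compact_cball] by blast
qed simp

lemma norm_partial_products_tendsto:
  assumes "norm z \<le> 1" "z \<noteq> 1"
  shows "(\<lambda>N. \<Prod>n<N. norm (blaschke_factor (a n) z)) \<longlonglongrightarrow> norm (P z)"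
  using tendsto_norm[OF partial_products_tendsto[OF assms]] by (simp add: prod_norm)

lemma norm_P_le_1:
  assumes "norm z \<le> 1" "z \<noteq> 1"
  shows "norm (P z) \<le> 1"
  by (rule LIMSEQ_le_const2[OF norm_partial_products_tendsto[OF assms]])
     (use norm_blaschke_factor_le_1[OF zero_norm_le_1 assms(1)] in \<open>auto intro!: prod_le_1\<close>)

lemma norm_P_eq_1:
  assumes "norm z = 1" "z \<noteq> 1"
  shows "norm (P z) = 1"
proof -
  have "norm (blaschke_factor (a n) z) = 1" for n
    using norm_blaschke_factor_eq_1[of z "a n"] denominator_ne_0[of z n] assms by simp
  then show ?thesis
    using norm_partial_products_tendsto[of z] assms by (simp add: LIMSEQ_const_iff)
qed

end

section \<open>The atomic inner function\<close>

lemma Re_inverse_cayley: "Re ((1 + z) / (1 - z)) = (1 - (norm z)\<^sup>2) / (norm (1 - z))\<^sup>2"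
  by (simp add: Re_divide cmod_power2) (simp add: algebra_simps power2_eq_square)

lemma norm_atomic_inner:
  "norm (atomic_inner z) = exp (- ((1 - (norm z)\<^sup>2) / (norm (1 - z))\<^sup>2))"
  unfolding atomic_inner_def norm_exp_eq_Re uminus_complex.sel Re_inverse_cayley ..

lemma norm_atomic_inner_le_1:
  assumes "norm z \<le> 1"
  shows "norm (atomic_inner z) \<le> 1"
  using assms by (simp add: norm_atomic_inner power_le_one)

lemma norm_atomic_inner_eq_1: "norm z = 1 \<Longrightarrow> norm (atomic_inner z) = 1"
  by (simp add: norm_atomic_inner)

lemma holomorphic_atomic_inner: "atomic_inner holomorphic_on - {1}"
proof -
  have "(\<lambda>z. exp (- ((1 + z) / (1 - z)))) holomorphic_on - {1}"
    by (intro holomorphic_intros) auto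
  then show ?thesis
    by (simp add: atomic_inner_def[abs_def])
qed

section \<open>The product is inner\<close>

lemma AE_cis_ne_1: "AE t\<in>{0..2 * pi} in lborel. cis t \<noteq> 1"
proof -
  have ne: "cis t \<noteq> 1" if "t \<in> {0..2 * pi}" "t \<noteq> 0" "t \<noteq> 2 * pi" for t
  proof
    assume "cis t = 1"
    then have "cos t = 1"
      by (simp add: complex_eq_iff)
    then obtain n :: int where n: "t = of_int n * (2 * pi)"
      using cos_one_2pi_int by auto
    have "0 < t" "t < 2 * pi"
      using that by auto
    then have "0 < real_of_int n" "real_of_int n < 1"
      unfolding n by (simp_all add: zero_less_mult_iff)
    then have "0 < n" "n < 1"
      by simp_all
    then show False
      by simp
  qed
  show ?thesis
    using AE_lborel_singleton[of 0] AE_lborel_singleton[of "2 * pi"]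
    by eventually_elim (use ne in auto)
qed

text \<open>
  Every radius except the one ending at 1 lies in a compact set on which the extension \<open>v\<close> is
  continuous, so the radial limit is simply a value of \<open>v\<close>.
\<close>

lemma inner_function_if_continuous_off_1:
  assumes hol: "u holomorphic_on unit_disk"
    and le: "\<And>z. norm z < 1 \<Longrightarrow> norm (u z) \<le> 1"
    and eq: "\<And>z. z \<in> unit_disk \<Longrightarrow> u z = v z"
    and cont: "\<And>K. compact K \<Longrightarrow> K \<subseteq> cball 0 1 - {1} \<Longrightarrow> continuous_on K v"
    and unimodular: "\<And>z. norm z = 1 \<Longrightarrow> z \<noteq> 1 \<Longrightarrow> norm (v z) = 1"
  shows "inner_function u"
  unfolding inner_function_def
proof (intro conjI ballI)
  have "\<exists>l. ((\<lambda>r. u (of_real r * cis t)) \<longlongrightarrow> l) (at_left 1) \<and> norm l = 1" if t: "cis t \<noteq> 1" for t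
  proof (intro exI conjI)
    let ?K = "(\<lambda>r. of_real r * cis t) ` {0..1}"
    have "of_real r * cis t \<noteq> 1" if "r \<in> {0..1}" for r :: real
    proof
      assume *: "of_real r * cis t = 1"
      then have "\<bar>r\<bar> * 1 = 1"
        by (metis norm_cis norm_mult norm_of_real norm_one)
      with that have "r = 1"
        by simp
      with * t show False
        by simp
    qed
    then have "?K \<subseteq> cball 0 1 - {1}"
      by (auto simp: norm_mult)
    moreover have "compact ?K"
      by (intro compact_continuous_image continuous_intros) auto
    ultimately have "continuous_on {0..1} (\<lambda>r. v (of_real r * cis t))"
      by (intro continuous_on_compose2[OF cont[of ?K]] continuous_intros) auto
    then have "((\<lambda>r. v (of_real r * cis t)) \<longlongrightarrow> v (of_real 1 * cis t)) (at_left 1)"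
      by (rule continuous_on_Icc_at_leftD) simp
    moreover have "\<forall>\<^sub>F r in at_left 1. v (of_real r * cis t) = u (of_real r * cis t)"
      using eventually_at_left_real[OF zero_less_one] by eventually_elim (auto simp: eq norm_mult)
    ultimately show "((\<lambda>r. u (of_real r * cis t)) \<longlongrightarrow> v (of_real 1 * cis t)) (at_left 1)"
      by (rule Lim_transform_eventually)
    show "norm (v (of_real 1 * cis t)) = 1"
      using unimodular t by simp
  qed
  then show "AE t\<in>{0..2 * pi} in lborel.
      \<exists>l. ((\<lambda>r. u (of_real r * cis t)) \<longlongrightarrow> l) (at_left 1) \<and> norm l = 1"
    using AE_cis_ne_1 by (elim AE_mp) auto
qed (use hol le in auto)

section \<open>Monotonicity in the half-plane\<close>

definition cayley :: "complex \<Rightarrow> complex" where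
  "cayley w = (w - 1) / (w + 1)"

lemma norm_cayley_less_1:
  assumes "0 < Re w"
  shows "norm (cayley w) < 1"
proof -
  have "(norm (w - 1))\<^sup>2 < (norm (w + 1))\<^sup>2"
    using assms by (simp add: cmod_power2) (simp add: power2_eq_square algebra_simps)
  then have "norm (w - 1) < norm (w + 1)"
    by (rule power_less_imp_less_base) simp
  then show ?thesis
    unfolding cayley_def norm_divide by (subst divide_less_eq_1) (smt (verit) norm_ge_zero)
qed

lemma cayley_ne_1: "0 < Re w \<Longrightarrow> cayley w \<noteq> 1"
  using norm_cayley_less_1[of w] by auto

lemma inverse_cayley:
  assumes "z \<noteq> 1"
  shows "cayley ((1 + z) / (1 - z)) = z"
proof -
  have "(1 + z) / (1 - z) - 1 = 2 * z / (1 - z)" "(1 + z) / (1 - z) + 1 = 2 / (1 - z)"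
    using assms by (simp_all add: field_simps)
  then show ?thesis
    using assms by (simp add: cayley_def)
qed

lemma inverse_cayley_cayley:
  assumes "0 < Re w"
  shows "(1 + cayley w) / (1 - cayley w) = w"
proof -
  have "w + 1 \<noteq> 0"
    using assms by (auto simp: complex_eq_iff)
  then have "1 + cayley w = 2 * w / (w + 1)" "1 - cayley w = 2 / (w + 1)"
    by (simp_all add: cayley_def field_simps)
  then show ?thesis
    using \<open>w + 1 \<noteq> 0\<close> by simp
qed

lemma norm_atomic_inner_cayley:
  assumes "0 < Re w"
  shows "norm (atomic_inner (cayley w)) = exp (- Re w)"
  unfolding atomic_inner_def inverse_cayley_cayley[OF assms] by (simp add: norm_exp_eq_Re)

lemma norm_blaschke_factor_cayley:
  assumes "0 < Re w" "a \<noteq> 1"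
  defines "p \<equiv> (1 + a) / (1 - a)"
  shows "norm (blaschke_factor a (cayley w)) = norm (w - p) / norm (w + cnj p)"
proof -
  have w: "w + 1 \<noteq> 0"
    using assms by (auto simp: complex_eq_iff)
  have a: "1 - a \<noteq> 0" "1 - cnj a \<noteq> 0"
    using assms by (auto simp: complex_eq_iff)
  have "a - cayley w = (1 - a) * (p - w) / (w + 1)"
    using w a by (simp add: cayley_def p_def divide_simps) (simp add: algebra_simps)
  moreover have "1 - cnj a * cayley w = cnj (1 - a) * (w + cnj p) / (w + 1)"
    using w a by (simp add: cayley_def p_def divide_simps) (simp add: algebra_simps)
  ultimately show ?thesis
    using w a by (simp add: norm_blaschke_factor norm_mult norm_divide norm_minus_commute
        del: complex_cnj_diff)
qed

text \<open>
  With \<open>s = Re p\<close> and \<open>t = (y - Im p)\<^sup>2\<close>, cross-multiplication reduces the inequality between the squares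
  to \<open>0 \<le> 4 * s * (x' - x) * (s\<^sup>2 + t - x * x')\<close>, which holds since \<open>x * x' \<le> s\<^sup>2\<close>. This is where the zeros
  have to lie to the right of the strip.
\<close>

lemma norm_reflection_quotient_antimono:
  assumes "0 < x" "x \<le> x'" "x' \<le> Re p"
  shows "norm (Complex x' y - p) / norm (Complex x' y + cnj p)
       \<le> norm (Complex x y - p) / norm (Complex x y + cnj p)"
proof -
  define s where "s = Re p"
  define t where "t = (y - Im p)\<^sup>2"
  have s: "x \<le> s" "x' \<le> s" "0 < s" and t: "0 \<le> t"
    using assms by (auto simp: s_def t_def)
  have q: "(norm (Complex u y - p))\<^sup>2 = (u - s)\<^sup>2 + t"
    "(norm (Complex u y + cnj p))\<^sup>2 = (u + s)\<^sup>2 + t" for u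
    by (simp_all add: cmod_power2 s_def t_def)
  have pos: "0 < (u + s)\<^sup>2 + t" if "0 < u" for u
    using that s t by (simp add: add_pos_nonneg)
  have "x * x' \<le> s * s"
    using s assms by (intro mult_mono) auto
  then have "0 \<le> 4 * s * ((x' - x) * (s * s + t - x * x'))"
    using assms s t by (intro mult_nonneg_nonneg) auto
  then have "((x' - s)\<^sup>2 + t) * ((x + s)\<^sup>2 + t) \<le> ((x - s)\<^sup>2 + t) * ((x' + s)\<^sup>2 + t)"
    by (simp add: power2_eq_square algebra_simps)
  then have "((x' - s)\<^sup>2 + t) / ((x' + s)\<^sup>2 + t) \<le> ((x - s)\<^sup>2 + t) / ((x + s)\<^sup>2 + t)"
    using pos[of x] pos[of x'] assms by (simp add: divide_simps)
  then have "(norm (Complex x' y - p) / norm (Complex x' y + cnj p))\<^sup>2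
       \<le> (norm (Complex x y - p) / norm (Complex x y + cnj p))\<^sup>2"
    by (simp add: power_divide q)
  then show ?thesis
    by (rule power2_le_imp_le) simp
qed

lemma norm_blaschke_factor_cayley_antimono:
  assumes "a \<in> horodisk L" "0 < x" "x \<le> x'" "x' \<le> L"
  shows "norm (blaschke_factor a (cayley (Complex x' y)))
       \<le> norm (blaschke_factor a (cayley (Complex x y)))"
proof (cases "a = 1")
  case True
  then show ?thesis
    using assms cayley_ne_1[of "Complex x y"] cayley_ne_1[of "Complex x' y"]
    by (simp add: norm_blaschke_factor)
next
  case False
  then have "L \<le> (1 - (norm a)\<^sup>2) / (norm (1 - a))\<^sup>2"
    using assms(1) by (simp add: horodisk_def pos_le_divide_eq)
  then have "L \<le> Re ((1 + a) / (1 - a))"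
    by (simp only: Re_inverse_cayley)
  then show ?thesis
    using assms False norm_reflection_quotient_antimono[of x x' "(1 + a) / (1 - a)" y]
    by (simp add: norm_blaschke_factor_cayley)
qed

section \<open>Connectedness of the sublevel set\<close>

text \<open>
  Each point of the set reaches the half-plane by a horizontal segment inside the set. So the set is
  the union of the half-planes with one such segment attached, which are connected and all share the
  half-plane.
\<close>

lemma connected_half_plane_union_segments:
  assumes half_plane: "{w. L \<le> Re w} \<subseteq> W"
    and rightwards: "\<And>x x' y. Complex x y \<in> W \<Longrightarrow> x \<le> x' \<Longrightarrow> x' \<le> L \<Longrightarrow> Complex x' y \<in> W"
  shows "connected W"
proof -
  let ?H = "{w. L \<le> Re w}"
  define S where "S w = ?H \<union> closed_segment w (Complex L (Im w))" for w
  have H: "connected ?H" "of_real L \<in> ?H"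
    by (auto intro!: convex_connected convex_halfspace_Re_ge)
  have "Complex L (Im w) \<in> ?H \<inter> closed_segment w (Complex L (Im w))" for w
    by simp
  then have "connected (S w)" for w
    unfolding S_def by (intro connected_Un H connected_segment) blast
  moreover have "of_real L \<in> (\<Inter>w\<in>W. S w)"
    using H(2) by (simp add: S_def)
  ultimately have "connected (\<Union>w\<in>W. S w)"
    by (intro connected_Union) blast+
  moreover have "(\<Union>w\<in>W. S w) = W"
  proof
    show "W \<subseteq> (\<Union>w\<in>W. S w)"
      by (auto simp: S_def)
    show "(\<Union>w\<in>W. S w) \<subseteq> W"
    proof safe
      fix w v assume w: "w \<in> W" and v: "v \<in> S w"
      show "v \<in> W"
      proof (cases "L \<le> Re v")
        case True
        then show ?thesis
          using half_plane by auto
      next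
        case False
        with v obtain k where k: "0 \<le> k" "k \<le> 1" "v = (1 - k) *\<^sub>R w + k *\<^sub>R Complex L (Im w)"
          by (auto simp: S_def closed_segment_def)
        then have "Im v = Im w" and Re: "Re v = Re w + k * (L - Re w)" "L - Re v = (1 - k) * (L - Re w)"
          unfolding k(3) by (simp_all add: algebra_simps)
        moreover have "Re w \<le> L"
          using False k(2) Re(2) by (smt (verit) mult_nonneg_nonpos)
        moreover have "Re w \<le> Re v"
          using Re(1) k(1) \<open>Re w \<le> L\<close> by simp
        ultimately show ?thesis
          using rightwards[of "Re w" "Im w" "Re v"] w False by (metis complex.collapse linear)
      qed
    qed
  qed
  ultimately show ?thesis
    by simp
qed

context horodisk_zeros
begin

lemma norm_P_cayley_antimono:
  assumes "0 < x" "x \<le> x'" "x' \<le> L"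
  shows "norm (P (cayley (Complex x' y))) \<le> norm (P (cayley (Complex x y)))"
proof (rule LIMSEQ_le[OF norm_partial_products_tendsto norm_partial_products_tendsto])
  show "\<exists>N. \<forall>n\<ge>N. (\<Prod>k<n. norm (blaschke_factor (a k) (cayley (Complex x' y))))
      \<le> (\<Prod>k<n. norm (blaschke_factor (a k) (cayley (Complex x y))))"
    using norm_blaschke_factor_cayley_antimono[OF zeros assms] by (auto intro!: prod_mono)
qed (use assms norm_cayley_less_1 cayley_ne_1 in \<open>auto intro: less_imp_le\<close>)

text \<open>
  Any level strictly between \<open>exp (- L)\<close>, which bounds the modulus on the half-plane \<open>Re w \<ge> L\<close>, and 1
  would do.
\<close>

lemma connected_sublevel_mult_atomic_inner:
  "connected (sublevel (\<lambda>z. P z * atomic_inner z) (exp (- L / 2)))"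
proof -
  define W where
    "W = {w. 0 < Re w \<and> norm (P (cayley w) * atomic_inner (cayley w)) < exp (- L / 2)}"
  have "connected W"
  proof (rule connected_half_plane_union_segments)
    show "{w. L \<le> Re w} \<subseteq> W"
    proof
      fix w assume "w \<in> {w. L \<le> Re w}"
      then have w: "L \<le> Re w" "0 < Re w"
        using L_pos by auto
      have "norm (P (cayley w)) * exp (- Re w) \<le> 1 * exp (- L)"
        using norm_cayley_less_1[OF w(2)] cayley_ne_1[OF w(2)] w
        by (intro mult_mono norm_P_le_1) auto
      also have "\<dots> < exp (- L / 2)"
        using L_pos by simp
      finally show "w \<in> W"
        using w by (simp add: W_def norm_mult norm_atomic_inner_cayley)
    qed
  next
    fix x x' y assume *: "Complex x y \<in> W" "x \<le> x'" "x' \<le> L"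
    then have x: "0 < x" "norm (P (cayley (Complex x y))) * exp (- x) < exp (- L / 2)"
      by (auto simp: W_def norm_mult norm_atomic_inner_cayley)
    have "norm (P (cayley (Complex x' y))) * exp (- x')
        \<le> norm (P (cayley (Complex x y))) * exp (- x)"
      using * x(1) by (intro mult_mono norm_P_cayley_antimono) auto
    with x * show "Complex x' y \<in> W"
      by (simp add: W_def norm_mult norm_atomic_inner_cayley)
  qed
  moreover have "sublevel (\<lambda>z. P z * atomic_inner z) (exp (- L / 2)) = cayley ` W"
  proof (intro equalityI subsetI)
    fix z assume z: "z \<in> sublevel (\<lambda>z. P z * atomic_inner z) (exp (- L / 2))"
    then have z1: "norm z < 1" "z \<noteq> 1"
      by (auto simp: sublevel_def)
    have "0 < Re ((1 + z) / (1 - z))"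
      unfolding Re_inverse_cayley using z1
      by (intro divide_pos_pos) (auto simp: abs_square_less_1)
    with z have "(1 + z) / (1 - z) \<in> W"
      by (simp add: W_def sublevel_def inverse_cayley[OF z1(2)])
    then show "z \<in> cayley ` W"
      using inverse_cayley[OF z1(2)] by (metis image_eqI)
  qed (auto simp: W_def sublevel_def norm_cayley_less_1)
  moreover have "continuous_on W cayley"
    unfolding cayley_def by (intro continuous_intros) (auto simp: W_def complex_eq_iff)
  ultimately show ?thesis
    by (simp add: connected_continuous_image)
qed

theorem one_component_inner_mult_atomic_inner:
  assumes c: "norm c = 1" and B: "\<And>w. w \<in> unit_disk \<Longrightarrow> B w = c * P w"
  shows "one_component_inner (\<lambda>w. B w * atomic_inner w)"
  unfolding one_component_inner_def
proof (intro conjI exI)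
  have hol: "atomic_inner holomorphic_on unit_disk"
    by (rule holomorphic_on_subset[OF holomorphic_atomic_inner]) auto
  show "inner_function (\<lambda>w. B w * atomic_inner w)"
  proof (rule inner_function_if_continuous_off_1[where v = "\<lambda>w. c * P w * atomic_inner w"])
    have "(\<lambda>w. c * P w * atomic_inner w) holomorphic_on unit_disk"
      by (intro holomorphic_intros hol holomorphic_P)
    then show "(\<lambda>w. B w * atomic_inner w) holomorphic_on unit_disk"
      by (rule holomorphic_transform) (simp add: B)
  next
    fix z :: complex assume z: "norm z < 1"
    then have "norm (P z) * norm (atomic_inner z) \<le> 1 * 1"
      by (intro mult_mono norm_P_le_1 norm_atomic_inner_le_1) auto
    with z c show "norm (B z * atomic_inner z) \<le> 1"
      by (simp add: B norm_mult)
  next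
    fix K :: "complex set" assume K: "compact K" "K \<subseteq> cball 0 1 - {1}"
    then have "continuous_on K atomic_inner"
      by (intro continuous_on_subset[OF holomorphic_on_imp_continuous_on[OF holomorphic_atomic_inner]])
         auto
    then show "continuous_on K (\<lambda>w. c * P w * atomic_inner w)"
      by (intro continuous_intros continuous_on_P K)
  qed (use c in \<open>auto simp: B norm_mult norm_P_eq_1 norm_atomic_inner_eq_1\<close>)
  have "sublevel (\<lambda>w. B w * atomic_inner w) (exp (- L / 2))
      = sublevel (\<lambda>z. P z * atomic_inner z) (exp (- L / 2))"
    using c by (auto simp: sublevel_def B norm_mult)
  then show "connected (sublevel (\<lambda>w. B w * atomic_inner w) (exp (- L / 2)))"
    using connected_sublevel_mult_atomic_inner by simp
qed (use L_pos in auto)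

end

section \<open>Both kinds of Blaschke products\<close>

text \<open>
  The Cayley transform of \<open>a\<close> has real part \<open>(1 - (norm a)\<^sup>2) / (norm (1 - a))\<^sup>2\<close>, so \<open>L\<close> is the smallest
  of finitely many positive numbers; the extra entry 1 takes care of the empty set.
\<close>

lemma finite_set_subset_horodisk:
  assumes "finite A" "A \<subseteq> unit_disk"
  obtains L where "0 < L" "A \<subseteq> horodisk L"
proof -
  define L where "L = Min (insert 1 ((\<lambda>a. (1 - (norm a)\<^sup>2) / (norm (1 - a))\<^sup>2) ` A))"
  have pos: "0 < (norm (1 - a))\<^sup>2" "0 < 1 - (norm a)\<^sup>2" if "a \<in> A" for a
    using assms(2) that by (auto simp: abs_square_less_1)
  show ?thesis
  proof
    show "0 < L"
      using assms(1) pos by (auto simp: L_def)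
    have "L \<le> (1 - (norm a)\<^sup>2) / (norm (1 - a))\<^sup>2" if "a \<in> A" for a
      using assms(1) that by (auto simp: L_def)
    then show "A \<subseteq> horodisk L"
      using pos by (auto simp: horodisk_def pos_le_divide_eq)
  qed
qed

text \<open>
  For real \<open>x\<close> the condition of the horodisk is \<open>L * (1 - x) \<le> 1 + x\<close> after division by \<open>1 - x\<close>. As \<open>1 - x < 2\<close>,
  it holds with \<open>L = d / 2\<close> once all entries have distance at least \<open>d\<close> from -1.
\<close>

lemma real_sequence_subset_horodisk:
  assumes "range z \<subseteq> unit_disk" "range z \<subseteq> \<real>" "\<not> (- 1) islimpt range z"
  obtains L where "0 < L" "range z \<subseteq> horodisk L"
proof -
  obtain T where T: "open T" "-1 \<in> T" "\<And>y. y \<in> range z \<Longrightarrow> y \<in> T \<Longrightarrow> y = - 1"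
    using assms(3) by (auto simp: islimpt_def)
  then obtain d where d: "0 < d" "ball (- 1) d \<subseteq> T"
    using open_contains_ball by metis
  show ?thesis
  proof
    show "0 < d / 2"
      using d by simp
    show "range z \<subseteq> horodisk (d / 2)"
    proof
      fix y assume y: "y \<in> range z"
      then obtain x where x: "y = of_real x"
        using assms(2) by (auto elim: Reals_cases)
      have "y \<in> unit_disk"
        using assms(1) y by blast
      then have x1: "\<bar>x\<bar> < 1"
        by (simp add: x)
      have "y \<noteq> - 1"
        using \<open>y \<in> unit_disk\<close> by auto
      then have "y \<notin> T"
        using T(3)[OF y] by blast
      then have "y \<notin> ball (- 1) d"
        using d by blast
      then have "d \<le> dist (- 1) y"
        by simp
      also have "\<dots> = norm (of_real (1 + x) :: complex)"
        by (subst dist_commute) (simp add: x dist_norm add.commute)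
      also have "\<dots> = 1 + x"
        unfolding norm_of_real using x1 by simp
      finally have "d \<le> 1 + x" .
      moreover have "d / 2 * (1 - x) \<le> d / 2 * 2"
        using x1 d by (intro mult_left_mono) auto
      ultimately have "d / 2 * (1 - x) \<le> 1 + x"
        by linarith
      then have "d / 2 * (1 - x) * (1 - x) \<le> (1 + x) * (1 - x)"
        using x1 by (intro mult_right_mono) auto
      moreover have "norm (1 - y) = \<bar>1 - x\<bar>"
        unfolding x by (metis norm_of_real of_real_1 of_real_diff)
      ultimately show "y \<in> horodisk (d / 2)"
        by (simp add: horodisk_def x power2_eq_square algebra_simps)
    qed
  qed
qed

lemma prod_list_blaschke_factor_eq_prodinf:
  assumes "z \<noteq> 1"
  shows "(\<Prod>a\<leftarrow>as. blaschke_factor a z)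
    = prodinf (\<lambda>n. blaschke_factor (if n < length as then as ! n else 1) z)"
proof -
  have "prodinf (\<lambda>n. blaschke_factor (if n < length as then as ! n else 1) z)
      = (\<Prod>n<length as. blaschke_factor (if n < length as then as ! n else 1) z)"
    using assms by (intro prodinf_finite) (auto simp: blaschke_factor_def)
  then show ?thesis
    by (subst prod.list_conv_set_nth) (simp add: atLeast0LessThan)
qed

theorem proposition2p8:
  fixes B :: "complex \<Rightarrow> complex"
  assumes "finite_blaschke_product B \<or>
    (\<exists>z. interpolating_blaschke_product B z \<and> range z \<subseteq> \<real> \<and>
         {p. p islimpt range z} = {1})"
  shows "one_component_inner (\<lambda>w. B w * atomic_inner w)"
  using assms
proof (elim disjE exE conjE)
  assume "finite_blaschke_product B"
  then obtain c as where c: "norm c = 1" and as: "set as \<subseteq> unit_disk"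
    and B: "\<And>w. w \<in> unit_disk \<Longrightarrow> B w = c * (\<Prod>a\<leftarrow>as. blaschke_factor a w)"
    by (auto simp: finite_blaschke_product_def)
  obtain L where L: "0 < L" "set as \<subseteq> horodisk L"
    using finite_set_subset_horodisk[OF finite_set as] by blast
  define a where "a n = (if n < length as then as ! n else 1)" for n
  interpret horodisk_zeros L a
  proof
    show "a n \<in> horodisk L" for n
      using L(2) by (auto simp: a_def horodisk_def subset_iff)
    show "summable (\<lambda>n. 1 - norm (a n))"
      by (rule summable_finite[of "{..<length as}"]) (auto simp: a_def)
  qed (rule L)
  show ?thesis
  proof (rule one_component_inner_mult_atomic_inner[OF c])
    fix w :: complex assume w: "w \<in> unit_disk"
    then have "w \<noteq> 1"
      by auto
    with w show "B w = c * P w"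
      using prod_list_blaschke_factor_eq_prodinf[of w as] by (auto simp: B P_def a_def)
  qed
next
  fix z assume z: "interpolating_blaschke_product B z" "range z \<subseteq> \<real>" "{p. p islimpt range z} = {1}"
  then have bp: "blaschke_product B z"
    by (simp add: interpolating_blaschke_product_def)
  then obtain c where c: "norm c = 1"
    and B: "\<And>w. w \<in> unit_disk \<Longrightarrow> B w = c * prodinf (\<lambda>n. blaschke_factor (z n) w)"
    by (auto simp: blaschke_product_def)
  have "- 1 \<notin> {p. p islimpt range z}"
    unfolding z(3) by simp
  then obtain L where L: "0 < L" "range z \<subseteq> horodisk L"
    using real_sequence_subset_horodisk[of z] z(2) bp by (auto simp: blaschke_product_def)
  interpret horodisk_zeros L z
    by unfold_locales (use L bp in \<open>auto simp: blaschke_product_def\<close>)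
  show ?thesis
    using one_component_inner_mult_atomic_inner[OF c] B by (simp add: P_def)
qed

end
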